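(* Let $G=(S,T;E)$ with $S=\{s_1,\dots,s_n\}$, $w:E\to\mathbb R_+$ and $d\in\mathbb Z_+$. Consider the algorithm Greedy: order the edges as $e_1,\dots,e_m$ so that $w(e_1)\ge\dots\ge w(e_m)$ (ties broken arbitrarily), start with $M=\emptyset$, and for $i=1,\dots,m$ replace $M$ by $M\cup\{e_i\}$ whenever $M\cup\{e_i\}$ is a $d$-distance matching; output $M$. Then the output $M$ is a $d$-distance matching with $3\,w(M)\ge w(M^* )$ for every $d$-distance matching $M^*$ of $G$; i.e., Greedy is a $3$-approximation algorithm for the maximum-weight $d$-distance matching problem.
   Context: $G$ is finite, bipartite, without loops or parallel edges, and the nodes of $S$ are in the fixed order $s_1,\dots,s_n$. A $d$-distance matching is a subset $M\subseteq E$ such that every node of $S$ is incident to at most one edge of $M$, and whenever $s_it,s_jt\in M$ with $i\ne j$, $t\in T$, we have $|j-i|\ge d$. $w(M)=\sum_{e\in M}w(e)$. *)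

theory Defs
  imports Complex_Main
begin

text \<open>
  A finite bipartite graph \<open>(S, T; E)\<close> on one vertex type. Edges are unordered pairs \<open>{u, v}\<close>,
  so there are no parallel edges; disjointness of the two classes excludes loops.
\<close>

definition bipartite_graph :: "'a set \<Rightarrow> 'a set \<Rightarrow> 'a set set \<Rightarrow> bool" where
  "bipartite_graph S T E \<longleftrightarrow>
     finite S \<and> finite T \<and> S \<inter> T = {} \<and> (\<forall>e\<in>E. \<exists>u\<in>S. \<exists>v\<in>T. e = {u, v})"

text \<open>
  The node \<open>s\<^sub>i\<close> is \<open>s i\<close> for \<open>1 \<le> i \<le> n\<close>; values of \<open>s\<close> outside \<open>{1..n}\<close> are irrelevant.
  Index differences are taken in \<open>int\<close> because subtraction on \<open>nat\<close> truncates.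
\<close>

definition distance_matching ::
    "(nat \<Rightarrow> 'a) \<Rightarrow> nat \<Rightarrow> 'a set \<Rightarrow> 'a set set \<Rightarrow> nat \<Rightarrow> 'a set set \<Rightarrow> bool" where
  "distance_matching s n T E d M \<longleftrightarrow>
     M \<subseteq> E \<and>
     (\<forall>i\<in>{1..n}. \<exists>\<^sub>\<le>\<^sub>1e. e \<in> M \<and> s i \<in> e) \<and>
     (\<forall>i\<in>{1..n}. \<forall>j\<in>{1..n}. \<forall>t\<in>T.
        i \<noteq> j \<longrightarrow> {s i, t} \<in> M \<longrightarrow> {s j, t} \<in> M \<longrightarrow> \<bar>int j - int i\<bar> \<ge> int d)"

text \<open>
  An admissible order of the edges lists each edge exactly once by nonincreasing weight;
  different ways of breaking ties are different admissible orders.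
\<close>

definition greedy_order :: "('e \<Rightarrow> real) \<Rightarrow> 'e set \<Rightarrow> 'e list \<Rightarrow> bool" where
  "greedy_order w E es \<longleftrightarrow>
     distinct es \<and> set es = E \<and> sorted_wrt (\<lambda>e f. w e \<ge> w f) es"

definition greedy ::
    "(nat \<Rightarrow> 'a) \<Rightarrow> nat \<Rightarrow> 'a set \<Rightarrow> 'a set set \<Rightarrow> nat \<Rightarrow> 'a set list \<Rightarrow> 'a set set" where
  "greedy s n T E d es =
     fold (\<lambda>e M. if distance_matching s n T E d (M \<union> {e}) then M \<union> {e} else M) es {}"

end

theory Submission
  imports Defs
begin

text \<open>
  An edge rejected by Greedy conflicts with an edge accepted earlier, which is at least as heavy;
  charge every edge of \<open>M\<^sup>*\<close> to such an accepted edge, and every accepted edge to itself. An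
  accepted edge \<open>s\<^sub>i t\<close> is charged at most three times, since \<open>M\<^sup>*\<close> contains at most one edge
  at \<open>s\<^sub>i\<close>, at most one edge \<open>s\<^sub>j t\<close> with \<open>i - d < j < i\<close>, and at most one with \<open>i < j < i + d\<close>.
\<close>

text \<open>Greedy for an arbitrary feasibility predicate \<open>P\<close>, so that the charging
  argument is separated from graphs. \<open>P\<close> need not be closed under subsets:
  \<open>P {}\<close> and a conflict relation suffice below.\<close>

definition greedy_on :: "('e set \<Rightarrow> bool) \<Rightarrow> 'e list \<Rightarrow> 'e set" where
  "greedy_on P es = fold (\<lambda>e M. if P (M \<union> {e}) then M \<union> {e} else M) es {}"

lemma greedy_on_Nil [simp]: "greedy_on P [] = {}"
  by (simp add: greedy_on_def)

lemma greedy_on_snoc [simp]: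
  "greedy_on P (es @ [x]) =
     (if P (insert x (greedy_on P es)) then insert x (greedy_on P es) else greedy_on P es)"
  by (simp add: greedy_on_def)

lemma greedy_on_subset: "greedy_on P es \<subseteq> set es"
  by (induction es rule: rev_induct) auto

lemma greedy_on_feasible: "P {} \<Longrightarrow> P (greedy_on P es)"
  by (induction es rule: rev_induct) auto

text \<open>Accepted elements are never removed, so witnesses found earlier survive. An accepted
  \<open>x\<close> is its own witness. If \<open>x\<close> is rejected, \<open>blocked\<close>
  yields a conflicting \<open>f\<close> in the current set, which contains only predecessors of
  \<open>x\<close>, so sortedness gives \<open>w x \<le> w f\<close>.\<close>

lemma greedy_on_blocked:
  fixes w :: "'e \<Rightarrow> 'b::order"
  assumes "P {}"
    and refl: "\<And>x. x \<in> set es \<Longrightarrow> R x x"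
    and blocked: "\<And>M x. P M \<Longrightarrow> M \<subseteq> set es \<Longrightarrow> x \<in> set es \<Longrightarrow> \<not> P (insert x M) \<Longrightarrow> \<exists>f\<in>M. R f x"
    and "sorted_wrt (\<lambda>e f. w e \<ge> w f) es"
  shows "\<forall>e\<in>set es. \<exists>f\<in>greedy_on P es. R f e \<and> w e \<le> w f"
  using refl blocked \<open>sorted_wrt _ es\<close>
proof (induction es rule: rev_induct)
  case Nil
  then show ?case by simp
next
  case (snoc x es)
  have IH: "\<forall>e\<in>set es. \<exists>f\<in>greedy_on P es. R f e \<and> w e \<le> w f"
  proof (rule snoc.IH)
    show "R y y" if "y \<in> set es" for y
      using that snoc.prems(1) by simp
    show "\<exists>f\<in>M. R f y" if "P M" "M \<subseteq> set es" "y \<in> set es" "\<not> P (insert y M)" for M y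
      using that by (intro snoc.prems(2)) auto
    show "sorted_wrt (\<lambda>e f. w e \<ge> w f) es"
      using snoc.prems(3) by (simp add: sorted_wrt_append)
  qed
  show ?case
  proof (cases "P (insert x (greedy_on P es))")
    case True
    then show ?thesis using IH snoc.prems(1)[of x] by auto
  next
    case False
    have "\<exists>f\<in>greedy_on P es. R f x"
      by (rule snoc.prems(2))
        (use False greedy_on_subset[of P es] greedy_on_feasible[of P es] \<open>P {}\<close> in auto)
    then show ?thesis
      using False IH greedy_on_subset[of P es] snoc.prems(3) by (auto simp: sorted_wrt_append)
  qed
qed

text \<open>Double counting: by nonnegativity, \<open>w a\<close> is at most the total weight of all
  \<open>b\<close> related to \<open>a\<close>. After exchanging the sums, each \<open>w b\<close>
  occurs once for every \<open>a\<close> charged to it, hence at most \<open>k\<close>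
  times.\<close>

lemma sum_le_charging:
  fixes w :: "'e \<Rightarrow> real"
  assumes "finite A" "finite B"
    and "\<And>b. b \<in> B \<Longrightarrow> w b \<ge> 0"
    and charge: "\<And>a. a \<in> A \<Longrightarrow> \<exists>b\<in>B. R b a \<and> w a \<le> w b"
    and degree: "\<And>b. b \<in> B \<Longrightarrow> card {a \<in> A. R b a} \<le> k"
  shows "sum w A \<le> real k * sum w B"
proof -
  have "sum w A \<le> (\<Sum>a\<in>A. \<Sum>b | b \<in> B \<and> R b a. w b)"
  proof (rule sum_mono)
    fix a assume "a \<in> A"
    then obtain b where b: "b \<in> B" "R b a" "w a \<le> w b" using charge by blast
    have "w b \<le> (\<Sum>b | b \<in> B \<and> R b a. w b)"
      by (rule member_le_sum) (use b assms in auto)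
    with b show "w a \<le> (\<Sum>b | b \<in> B \<and> R b a. w b)" by simp
  qed
  also have "\<dots> = (\<Sum>b\<in>B. \<Sum>a | a \<in> A \<and> R b a. w b)"
    using assms by (intro sum.swap_restrict)
  also have "\<dots> = (\<Sum>b\<in>B. real (card {a \<in> A. R b a}) * w b)" by simp
  also have "\<dots> \<le> (\<Sum>b\<in>B. real k * w b)"
    by (intro sum_mono mult_right_mono) (use assms degree in auto)
  finally show ?thesis by (simp add: sum_distrib_left)
qed

text \<open>For \<open>i = j\<close> the ends in \<open>T\<close> are unconstrained: this covers two
  edges at one node of \<open>S\<close> and also \<open>e = f\<close>, which allows an accepted edge
  to be charged to itself.\<close>

definition edge_conflict ::
    "(nat \<Rightarrow> 'a) \<Rightarrow> nat \<Rightarrow> 'a set \<Rightarrow> nat \<Rightarrow> 'a set \<Rightarrow> 'a set \<Rightarrow> bool" where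
  "edge_conflict s n T d e f \<longleftrightarrow>
     (\<exists>i\<in>{1..n}. \<exists>j\<in>{1..n}. \<exists>t\<in>T. \<exists>u\<in>T. e = {s i, t} \<and> f = {s j, u} \<and>
        (i = j \<or> t = u \<and> \<bar>int j - int i\<bar> < int d))"

context
  fixes s :: "nat \<Rightarrow> 'a" and n d :: nat and S T :: "'a set" and E :: "'a set set"
  assumes graph: "bipartite_graph S T E"
    and enum: "bij_betw s {1..n} S"
begin

lemma s_notin_T: "i \<in> {1..n} \<Longrightarrow> s i \<notin> T"
  using graph bij_betwE[OF enum] by (auto simp: bipartite_graph_def)

lemma s_mem_edge: "i \<in> {1..n} \<Longrightarrow> j \<in> {1..n} \<Longrightarrow> t \<in> T \<Longrightarrow> s i \<in> {s j, t} \<longleftrightarrow> i = j"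
  using s_notin_T[of i] bij_betw_imp_inj_on[OF enum] by (auto dest: inj_onD)

text \<open>Since \<open>S\<close> and \<open>T\<close> are disjoint, the crossed identification of
  the two unordered pairs is impossible.\<close>

lemma edge_eq_iff:
  assumes "i \<in> {1..n}" "j \<in> {1..n}" "t \<in> T" "u \<in> T"
  shows "{s i, t} = {s j, u} \<longleftrightarrow> i = j \<and> t = u"
  using assms s_mem_edge[of i j u] s_notin_T by (auto simp: doubleton_eq_iff)

lemma edge_cases:
  assumes "e \<in> E"
  obtains i t where "i \<in> {1..n}" "t \<in> T" "e = {s i, t}"
proof -
  obtain u t where "u \<in> S" "t \<in> T" "e = {u, t}"
    using graph assms by (auto simp: bipartite_graph_def)
  moreover obtain i where "i \<in> {1..n}" "u = s i"
    using \<open>u \<in> S\<close> bij_betw_imp_surj_on[OF enum] by blast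
  ultimately show thesis using that by blast
qed

lemma edge_conflict_refl: "e \<in> E \<Longrightarrow> edge_conflict s n T d e e"
  unfolding edge_conflict_def by (erule edge_cases) blast

text \<open>As \<open>M\<close> itself is feasible, every violation in \<open>insert x M\<close>
  involves \<open>x\<close>; the other edge of the violating pair lies in \<open>M\<close> and is
  the required \<open>f\<close>.\<close>

lemma edge_conflict_if_blocked:
  assumes M: "distance_matching s n T E d M" and x: "x \<in> E"
    and not: "\<not> distance_matching s n T E d (insert x M)"
  shows "\<exists>f\<in>M. edge_conflict s n T d f x"
proof -
  obtain k u where k: "k \<in> {1..n}" "u \<in> T" "x = {s k, u}" using x by (rule edge_cases)
  have ME: "M \<subseteq> E" using M by (simp add: distance_matching_def)
  consider
    (node) i e f where "i \<in> {1..n}" "e \<in> insert x M" "f \<in> insert x M" "s i \<in> e" "s i \<in> f" "e \<noteq> f"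
  | (dist) i j t where "i \<in> {1..n}" "j \<in> {1..n}" "t \<in> T" "i \<noteq> j"
      "{s i, t} \<in> insert x M" "{s j, t} \<in> insert x M" "\<bar>int j - int i\<bar> < int d"
  proof -
    have "insert x M \<subseteq> E" using ME x by simp
    then consider
      "\<exists>i\<in>{1..n}. \<not> (\<exists>\<^sub>\<le>\<^sub>1e. e \<in> insert x M \<and> s i \<in> e)"
    | "\<exists>i\<in>{1..n}. \<exists>j\<in>{1..n}. \<exists>t\<in>T. i \<noteq> j \<and> {s i, t} \<in> insert x M \<and> {s j, t} \<in> insert x M \<and>
         \<not> int d \<le> \<bar>int j - int i\<bar>"
      using not unfolding distance_matching_def by blast
    then show thesis
    proof cases
      case 1
      then show thesis using node unfolding Uniq_def by blast
    next
      case 2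
      then show thesis using dist unfolding not_le by blast
    qed
  qed
  then show ?thesis
  proof cases
    case node
    have "\<not> (e \<in> M \<and> f \<in> M)"
      using M node unfolding distance_matching_def Uniq_def by blast
    \<comment> \<open>One of the distinct edges \<open>e\<close>, \<open>f\<close> must be
      \<open>x\<close>, and \<open>g\<close> is the other one.\<close>
    then obtain g where g: "g \<in> M" "s i \<in> g" "s i \<in> x" using node by blast
    obtain j t where j: "j \<in> {1..n}" "t \<in> T" "g = {s j, t}" using g ME by (blast elim: edge_cases)
    have "i = k" "i = j" using g j k node s_mem_edge by blast+
    then show ?thesis using g j k unfolding edge_conflict_def by blast
  next
    case dist
    have "\<not> ({s i, t} \<in> M \<and> {s j, t} \<in> M)"
      using M dist unfolding distance_matching_def by force
    moreover have "{s i, t} \<noteq> {s j, t}" using dist edge_eq_iff by blast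
    ultimately consider "{s i, t} = x" "{s j, t} \<in> M" | "{s j, t} = x" "{s i, t} \<in> M"
      using dist by auto
    then show ?thesis
    proof cases
      case 1
      \<comment> \<open>The edge from \<open>M\<close> is the first argument of the conflict, so the
        indices appear in exchanged order.\<close>
      have "\<bar>int i - int j\<bar> < int d" using dist by simp
      with 1 dist show ?thesis unfolding edge_conflict_def by blast
    next
      case 2
      with dist show ?thesis unfolding edge_conflict_def by blast
    qed
  qed
qed

text \<open>Two indices on the same side of \<open>i\<close>, both at distance less than
  \<open>d\<close> from it, are at distance less than \<open>d\<close> from each other. Hence
  \<open>M\<close> has at most one edge at \<open>t\<close> from each side, plus at most one at
  \<open>s i\<close>.\<close>

lemma card_edge_conflict_le:
  assumes M: "distance_matching s n T E d M" and "finite M" and "e \<in> E"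
  shows "card {f \<in> M. edge_conflict s n T d e f} \<le> 3"
proof -
  obtain i t where i: "i \<in> {1..n}" "t \<in> T" "e = {s i, t}" using \<open>e \<in> E\<close> by (rule edge_cases)
  define A where "A = {f \<in> M. s i \<in> f}"
  define B where "B I = {f \<in> M. \<exists>j\<in>{1..n} \<inter> I. f = {s j, t}}" for I
  \<comment> \<open>Writing \<open>i < j + d\<close> avoids the truncated difference
    \<open>i - d\<close>.\<close>
  let ?L = "{j. j < i \<and> i < j + d}" and ?U = "{j. i < j \<and> j < i + d}"
  have "card A \<le> 1"
    using M i \<open>finite M\<close> by (auto simp: card_le_Suc0_iff_eq A_def distance_matching_def Uniq_def)
  have card_B: "card (B I) \<le> 1"
    if close: "\<And>j k. j \<in> I \<Longrightarrow> k \<in> I \<Longrightarrow> \<bar>int k - int j\<bar> < int d" for I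
  proof -
    have "f = g" if "f \<in> B I" "g \<in> B I" for f g
    proof -
      obtain j k where jk: "j \<in> {1..n}" "j \<in> I" "f = {s j, t}" "k \<in> {1..n}" "k \<in> I" "g = {s k, t}"
        using \<open>f \<in> B I\<close> \<open>g \<in> B I\<close> unfolding B_def by blast
      have "f \<in> M" "g \<in> M" using that by (auto simp: B_def)
      then have "j = k"
        using M jk i close[of j k] unfolding distance_matching_def by force
      then show ?thesis using jk by simp
    qed
    then show ?thesis using \<open>finite M\<close> by (simp add: card_le_Suc0_iff_eq B_def)
  qed
  have "{f \<in> M. edge_conflict s n T d e f} \<subseteq> A \<union> B ?L \<union> B ?U"
  proof
    fix f assume "f \<in> {f \<in> M. edge_conflict s n T d e f}"
    then obtain i' j t' u where f: "f \<in> M" "i' \<in> {1..n}" "j \<in> {1..n}" "t' \<in> T" "u \<in> T"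
      "e = {s i', t'}" "f = {s j, u}" "i' = j \<or> t' = u \<and> \<bar>int j - int i'\<bar> < int d"
      unfolding edge_conflict_def by blast
    \<comment> \<open>The representation of \<open>e\<close> inside the conflict has to agree with
      the one fixed at the start.\<close>
    moreover have "i' = i \<and> t' = t" using f i edge_eq_iff by metis
    ultimately have f': "i = j \<or> t = u \<and> \<bar>int j - int i\<bar> < int d" by simp
    then consider "i = j" | "t = u" "j \<in> ?L" | "t = u" "j \<in> ?U" by force
    then show "f \<in> A \<union> B ?L \<union> B ?U"
      using f unfolding A_def B_def by cases blast+
  qed
  then have "card {f \<in> M. edge_conflict s n T d e f} \<le> card (A \<union> B ?L \<union> B ?U)"
    using \<open>finite M\<close> by (intro card_mono) (auto simp: A_def B_def)
  also have "\<dots> \<le> card A + card (B ?L) + card (B ?U)"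
    using card_Un_le[of A "B ?L"] card_Un_le[of "A \<union> B ?L" "B ?U"] by linarith
  also have "\<dots> \<le> 3"
  proof -
    have "card (B ?L) \<le> 1" "card (B ?U) \<le> 1" by (rule card_B; force)+
    with \<open>card A \<le> 1\<close> show ?thesis by simp
  qed
  finally show ?thesis .
qed

end

theorem theorem2:
  fixes s :: "nat \<Rightarrow> 'a" and n d :: nat
    and S T :: "'a set" and E :: "'a set set"
    and w :: "'a set \<Rightarrow> real" and es :: "'a set list"
  assumes "bipartite_graph S T E"
    and "bij_betw s {1..n} S"
    and "\<And>e. e \<in> E \<Longrightarrow> w e \<ge> 0"
    and "greedy_order w E es"
  shows "distance_matching s n T E d (greedy s n T E d es) \<and>
         (\<forall>M'. distance_matching s n T E d M' \<longrightarrow>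
            3 * (\<Sum>e\<in>greedy s n T E d es. w e) \<ge> (\<Sum>e\<in>M'. w e))"
proof -
  let ?P = "distance_matching s n T E d" and ?R = "edge_conflict s n T d"
  have es: "set es = E" "sorted_wrt (\<lambda>e f. w e \<ge> w f) es"
    using assms(4) by (auto simp: greedy_order_def)
  have G: "greedy s n T E d es = greedy_on ?P es"
    by (simp add: greedy_def greedy_on_def)
  have empty: "?P {}" by (simp add: distance_matching_def Uniq_def)
  have charge: "\<forall>e\<in>set es. \<exists>f\<in>greedy_on ?P es. ?R f e \<and> w e \<le> w f"
  proof (rule greedy_on_blocked)
    show "?R x x" if "x \<in> set es" for x
      using that edge_conflict_refl[OF assms(1,2)] es by blast
    show "\<exists>f\<in>M. ?R f x" if "?P M" "x \<in> set es" "\<not> ?P (insert x M)" for M x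
      using that edge_conflict_if_blocked[OF assms(1,2)] es by blast
  qed (use empty es in auto)
  have sub: "greedy_on ?P es \<subseteq> E" using greedy_on_subset[of ?P es] es by simp
  have fin: "finite E" using es by auto
  have "sum w M' \<le> 3 * sum w (greedy_on ?P es)" if M': "?P M'" for M'
  proof -
    have M'E: "M' \<subseteq> E" using M' by (simp add: distance_matching_def)
    then have "finite M'" using fin finite_subset by blast
    have "sum w M' \<le> real 3 * sum w (greedy_on ?P es)"
    proof (rule sum_le_charging)
      show "finite (greedy_on ?P es)" using sub fin finite_subset by blast
      show "w b \<ge> 0" if "b \<in> greedy_on ?P es" for b using that sub assms(3) by blast
      show "\<exists>b\<in>greedy_on ?P es. ?R b a \<and> w a \<le> w b" if "a \<in> M'" for a
        using that charge es M'E by blast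
      \<comment> \<open>The degree is counted inside the matching \<open>M'\<close>; of
        \<open>b\<close> only membership in \<open>E\<close> is needed.\<close>
      show "card {a \<in> M'. ?R b a} \<le> 3" if "b \<in> greedy_on ?P es" for b
        using that sub card_edge_conflict_le[OF assms(1,2) M' \<open>finite M'\<close>] by blast
    qed fact
    then show ?thesis by simp
  qed
  then show ?thesis using G greedy_on_feasible[of ?P, OF empty] by simp
qed

end
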